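(* Let $\mathcal H$ be a real Hilbert space, let $\mu\in\,]0,\infty[$, let $n\ge 1$ be an integer, $I=\{1,\dots,n\}$, and let $\lambda_i>0$ ($i\in I$) satisfy $\sum_{i\in I}\lambda_i=1$. Suppose that for each $i\in I$, $\epsilon_i\ge0$ is a real number and $A_i:\mathcal H\rightrightarrows\mathcal H$ is maximally monotone and $\epsilon_i$-monotone. Write $\mathbf A=(A_1,\dots,A_n)$, $\boldsymbol\lambda=(\lambda_1,\dots,\lambda_n)$. Then $\mathcal R_\mu(\mathbf A,\boldsymbol\lambda)$ is $\epsilon$-monotone, where $$\epsilon=r_\mu(\boldsymbol\epsilon,\boldsymbol\lambda)=\Big[\sum_{i\in I}\lambda_i(\epsilon_i+\mu^{-1})^{-1}\Big]^{-1}-\mu^{-1}.$$ In particular, if there exists $i_0\in I$ such that $A_{i_0}$ is $\epsilon_{i_0}$-strongly monotone, then $\mathcal R_\mu(\mathbf A,\boldsymbol\lambda)$ is $\epsilon$-strongly monotone.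
   Context: For $\epsilon\ge0$, a mapping $A:\mathcal H\rightrightarrows\mathcal H$ is $\epsilon$-monotone if $\epsilon\|x-y\|^2\le\langle u-v,x-y\rangle$ for all $(x,u),(y,v)$ in the graph of $A$; it is $\epsilon$-strongly monotone if it is $\epsilon$-monotone and $\epsilon>0$. The $\boldsymbol\lambda$-weighted resolvent average of $\mathbf A$ with parameter $\mu$ is the set-valued mapping $$\mathcal R_\mu(\mathbf A,\boldsymbol\lambda)=\Big(\sum_{i\in I}\lambda_i(A_i+\mu^{-1}\mathrm{Id})^{-1}\Big)^{-1}-\mu^{-1}\mathrm{Id},$$ where inverses are set-valued inverses ($x\in A^{-1}u\Leftrightarrow u\in Ax$), sums and multiples are pointwise Minkowski operations, and $\mathrm{Id}$ is the identity. *)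

theory Defs
  imports "HOL-Analysis.Analysis" "HOL-Library.Set_Algebras"
begin

(* A set-valued mapping A : H => H (double arrow) is a function into sets; the value may be empty.
   Addition of sets, and finite sums of sets, are the Minkowski operations of Set_Algebras;
   subtraction of sets would be set difference, so differences of mappings are written with a
   negative multiple. *)

type_synonym 'a setmap = "'a \<Rightarrow> 'a set"

definition graph :: "'a setmap \<Rightarrow> ('a \<times> 'a) set" where
  "graph A = {(x, u). u \<in> A x}"

definition sv_inverse :: "'a setmap \<Rightarrow> 'a setmap" where
  "sv_inverse A = (\<lambda>u. {x. u \<in> A x})"

definition sv_add :: "'a::plus setmap \<Rightarrow> 'a setmap \<Rightarrow> 'a setmap" where
  "sv_add A B = (\<lambda>x. A x + B x)"

definition sv_scale :: "real \<Rightarrow> 'a::real_vector setmap \<Rightarrow> 'a setmap" where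
  "sv_scale c A = (\<lambda>x. (\<lambda>u. c *\<^sub>R u) ` A x)"

definition sv_sum :: "('i \<Rightarrow> 'a::comm_monoid_add setmap) \<Rightarrow> 'i set \<Rightarrow> 'a setmap" where
  "sv_sum B I = (\<lambda>x. \<Sum>i\<in>I. B i x)"

definition sv_id :: "'a setmap" where
  "sv_id = (\<lambda>x. {x})"

definition sv_monotone :: "'a::real_inner setmap \<Rightarrow> bool" where
  "sv_monotone A \<longleftrightarrow>
    (\<forall>(x, u) \<in> graph A. \<forall>(y, v) \<in> graph A. 0 \<le> inner (u - v) (x - y))"

definition maximally_monotone :: "'a::real_inner setmap \<Rightarrow> bool" where
  "maximally_monotone A \<longleftrightarrow>
    sv_monotone A \<and> (\<forall>B. sv_monotone B \<and> graph A \<subseteq> graph B \<longrightarrow> graph B = graph A)"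

(* The notion only makes sense for a nonnegative modulus, so this is part of the definition. *)
definition eps_monotone :: "real \<Rightarrow> 'a::real_inner setmap \<Rightarrow> bool" where
  "eps_monotone \<epsilon> A \<longleftrightarrow> 0 \<le> \<epsilon> \<and>
    (\<forall>(x, u) \<in> graph A. \<forall>(y, v) \<in> graph A. \<epsilon> * (norm (x - y))\<^sup>2 \<le> inner (u - v) (x - y))"

definition strongly_monotone :: "real \<Rightarrow> 'a::real_inner setmap \<Rightarrow> bool" where
  "strongly_monotone \<epsilon> A \<longleftrightarrow> eps_monotone \<epsilon> A \<and> 0 < \<epsilon>"

definition resolvent_average ::
    "real \<Rightarrow> 'i set \<Rightarrow> ('i \<Rightarrow> 'a::real_inner setmap) \<Rightarrow> ('i \<Rightarrow> real) \<Rightarrow> 'a setmap" where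
  "resolvent_average \<mu> I A lam =
    sv_add
      (sv_inverse
        (sv_sum (\<lambda>i. sv_scale (lam i) (sv_inverse (sv_add (A i) (sv_scale (inverse \<mu>) sv_id)))) I))
      (sv_scale (- inverse \<mu>) sv_id)"

definition real_resolvent_average ::
    "real \<Rightarrow> 'i set \<Rightarrow> ('i \<Rightarrow> real) \<Rightarrow> ('i \<Rightarrow> real) \<Rightarrow> real" where
  "real_resolvent_average \<mu> I \<epsilon> lam =
    inverse (\<Sum>i\<in>I. lam i * inverse (\<epsilon> i + inverse \<mu>)) - inverse \<mu>"

end

theory Submission
  imports Defs
begin

text \<open>
  Put \<open>c\<^sub>i = \<epsilon>\<^sub>i + 1/\<mu>\<close>. Two points \<open>(x, u)\<close> and \<open>(y, v)\<close> in the graph of the resolvent average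
  decompose as \<open>x = \<Sum>\<^sub>i \<lambda>\<^sub>i x\<^sub>i\<close> and \<open>y = \<Sum>\<^sub>i \<lambda>\<^sub>i y\<^sub>i\<close>, where \<open>(x\<^sub>i, u + x/\<mu>)\<close> and \<open>(y\<^sub>i, v + y/\<mu>)\<close>
  lie in the graph of \<open>A\<^sub>i + Id/\<mu>\<close> for every \<open>i\<close>, with the same second components throughout. Write
  \<open>z\<close> for their difference. Since \<open>A\<^sub>i + Id/\<mu>\<close> is \<open>c\<^sub>i\<close>-monotone,
  \<open>c\<^sub>i \<parallel>x\<^sub>i - y\<^sub>i\<parallel>\<^sup>2 \<le> \<langle>z, x\<^sub>i - y\<^sub>i\<rangle>\<close>. Averaging with the weights \<open>\<lambda>\<^sub>i\<close> bounds
  \<open>\<Sum>\<^sub>i \<lambda>\<^sub>i c\<^sub>i \<parallel>x\<^sub>i - y\<^sub>i\<parallel>\<^sup>2\<close> by \<open>\<langle>z, x - y\<rangle>\<close>, and the weighted Cauchy-Schwarz inequality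
  (\<open>norm_weighted_sum_sq_le\<close>) bounds \<open>\<parallel>x - y\<parallel>\<^sup>2\<close> by \<open>\<Sum>\<^sub>i \<lambda>\<^sub>i / c\<^sub>i\<close> times the former sum. Subtracting
  \<open>\<parallel>x - y\<parallel>\<^sup>2 / \<mu>\<close> gives the claim. As \<open>c\<^sub>i \<ge> 1/\<mu>\<close>, the harmonic mean of the \<open>c\<^sub>i\<close> is at least
  \<open>1/\<mu>\<close>, and strictly larger once a single \<open>\<epsilon>\<^sub>i\<close> is positive; this settles the sign of the modulus.
\<close>

lemma norm_weighted_sum_sq_le:
  fixes d :: "'i \<Rightarrow> 'a::real_normed_vector" and lam c :: "'i \<Rightarrow> real"
  assumes lam: "\<And>i. i \<in> I \<Longrightarrow> 0 \<le> lam i" and c: "\<And>i. i \<in> I \<Longrightarrow> 0 < c i"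
  shows "(norm (\<Sum>i\<in>I. lam i *\<^sub>R d i))\<^sup>2
    \<le> (\<Sum>i\<in>I. lam i * inverse (c i)) * (\<Sum>i\<in>I. lam i * (c i * (norm (d i))\<^sup>2))"
proof -
  \<comment> \<open>Cauchy-Schwarz is applied to \<open>f\<close> and \<open>g\<close>, whose product is \<open>\<lambda>\<^sub>i \<parallel>d\<^sub>i\<parallel>\<close>.\<close>
  define f where "f i = sqrt (lam i * inverse (c i))" for i
  define g where "g i = sqrt (lam i * c i) * norm (d i)" for i
  have f2: "(f i)\<^sup>2 = lam i * inverse (c i)" if "i \<in> I" for i
    unfolding f_def using lam[OF that] c[OF that] by simp
  have g2: "(g i)\<^sup>2 = lam i * (c i * (norm (d i))\<^sup>2)" if "i \<in> I" for i
    unfolding g_def using lam[OF that] c[OF that] by (simp add: power_mult_distrib)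
  have fg: "f i * g i = norm (lam i *\<^sub>R d i)" if "i \<in> I" for i
  proof -
    have "sqrt (lam i * inverse (c i)) * sqrt (lam i * c i) = sqrt ((lam i)\<^sup>2)"
      unfolding real_sqrt_mult[symmetric] using c[OF that]
      by (simp add: power2_eq_square field_simps)
    then show ?thesis
      unfolding f_def g_def using lam[OF that] by (simp add: mult.assoc[symmetric])
  qed
  have "norm (\<Sum>i\<in>I. lam i *\<^sub>R d i) \<le> (\<Sum>i\<in>I. f i * g i)"
    using norm_sum[of "\<lambda>i. lam i *\<^sub>R d i" I] fg by simp
  then have "(norm (\<Sum>i\<in>I. lam i *\<^sub>R d i))\<^sup>2 \<le> (\<Sum>i\<in>I. f i * g i)\<^sup>2"
    by (intro power_mono) auto
  also have "\<dots> \<le> (\<Sum>i\<in>I. (f i)\<^sup>2) * (\<Sum>i\<in>I. (g i)\<^sup>2)"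
    by (rule Cauchy_Schwarz_ineq_sum)
  finally show ?thesis
    using f2 g2 by simp
qed

text \<open>
  Membership \<open>u \<in> R x\<close> in the resolvent average \<open>R\<close> means that \<open>x\<close> is a weighted sum of points
  \<open>p\<^sub>i\<close> with \<open>u + x/\<mu> \<in> A\<^sub>i p\<^sub>i + p\<^sub>i/\<mu>\<close>; only this decomposition of \<open>x\<close> is needed.
\<close>
lemma mem_resolvent_averageE:
  assumes "finite I" and "u \<in> resolvent_average \<mu> I A lam x"
  obtains p where "x = (\<Sum>i\<in>I. lam i *\<^sub>R p i)"
    and "\<And>i. i \<in> I \<Longrightarrow> u + inverse \<mu> *\<^sub>R x - inverse \<mu> *\<^sub>R p i \<in> A i (p i)"
proof -
  let ?J = "\<lambda>i. sv_inverse (sv_add (A i) (sv_scale (inverse \<mu>) sv_id))"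
  have "x \<in> sv_sum (\<lambda>i. sv_scale (lam i) (?J i)) I (u + inverse \<mu> *\<^sub>R x)"
    using assms(2)
    by (auto simp: resolvent_average_def sv_add_def sv_inverse_def sv_scale_def sv_id_def
        set_plus_def)
  then obtain q where q: "x = (\<Sum>i\<in>I. q i)"
      "\<And>i. i \<in> I \<Longrightarrow> q i \<in> sv_scale (lam i) (?J i) (u + inverse \<mu> *\<^sub>R x)"
    unfolding sv_sum_def set_sum_alt[OF assms(1)] by blast
  have "\<forall>i\<in>I. \<exists>p. q i = lam i *\<^sub>R p \<and> u + inverse \<mu> *\<^sub>R x - inverse \<mu> *\<^sub>R p \<in> A i p"
  proof
    fix i assume "i \<in> I"
    from q(2)[OF this] obtain p where p: "q i = lam i *\<^sub>R p" "p \<in> ?J i (u + inverse \<mu> *\<^sub>R x)"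
      by (auto simp: sv_scale_def)
    from p(2) obtain a where "a \<in> A i p" "u + inverse \<mu> *\<^sub>R x = a + inverse \<mu> *\<^sub>R p"
      by (auto simp: sv_add_def sv_inverse_def sv_scale_def sv_id_def set_plus_def)
    with p(1) show "\<exists>p. q i = lam i *\<^sub>R p \<and> u + inverse \<mu> *\<^sub>R x - inverse \<mu> *\<^sub>R p \<in> A i p"
      by (intro exI[of _ p]) simp
  qed
  then obtain p where p:
    "\<forall>i\<in>I. q i = lam i *\<^sub>R p i \<and> u + inverse \<mu> *\<^sub>R x - inverse \<mu> *\<^sub>R p i \<in> A i (p i)"
    by metis
  show thesis
  proof (rule that)
    show "x = (\<Sum>i\<in>I. lam i *\<^sub>R p i)"
      unfolding q(1) using p by (intro sum.cong) auto
  qed (use p in blast)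
qed

lemma eps_monotoneD:
  assumes "eps_monotone \<epsilon> A" "u \<in> A x" "v \<in> A y"
  shows "\<epsilon> * (norm (x - y))\<^sup>2 \<le> inner (u - v) (x - y)"
  using assms unfolding eps_monotone_def graph_def by blast

lemma real_resolvent_average_sum_bounds:
  fixes lam \<epsilon> :: "'i \<Rightarrow> real"
  assumes "finite I" "0 < \<mu>"
    and lam: "\<And>i. i \<in> I \<Longrightarrow> 0 < lam i" and sum1: "(\<Sum>i\<in>I. lam i) = 1"
    and eps: "\<And>i. i \<in> I \<Longrightarrow> 0 \<le> \<epsilon> i"
  shows "0 < (\<Sum>i\<in>I. lam i * inverse (\<epsilon> i + inverse \<mu>))"
    and "(\<Sum>i\<in>I. lam i * inverse (\<epsilon> i + inverse \<mu>)) \<le> \<mu>"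
    and "\<exists>i\<in>I. 0 < \<epsilon> i \<Longrightarrow> (\<Sum>i\<in>I. lam i * inverse (\<epsilon> i + inverse \<mu>)) < \<mu>"
proof -
  have "I \<noteq> {}"
    using sum1 by auto
  have total: "(\<Sum>i\<in>I. lam i * \<mu>) = \<mu>"
    using sum1 by (simp add: sum_distrib_right[symmetric])
  have pos: "0 < \<epsilon> i + inverse \<mu>" if "i \<in> I" for i
    using eps[OF that] assms(2) by (simp add: add_nonneg_pos)
  show "0 < (\<Sum>i\<in>I. lam i * inverse (\<epsilon> i + inverse \<mu>))"
    using assms(1) \<open>I \<noteq> {}\<close> lam pos by (intro sum_pos) auto
  have le: "lam i * inverse (\<epsilon> i + inverse \<mu>) \<le> lam i * \<mu>" if "i \<in> I" for i
    using le_imp_inverse_le[of "inverse \<mu>" "\<epsilon> i + inverse \<mu>"] lam[OF that] eps[OF that] assms(2)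
    by simp
  have "(\<Sum>i\<in>I. lam i * inverse (\<epsilon> i + inverse \<mu>)) \<le> (\<Sum>i\<in>I. lam i * \<mu>)"
    using le by (rule sum_mono)
  then show "(\<Sum>i\<in>I. lam i * inverse (\<epsilon> i + inverse \<mu>)) \<le> \<mu>"
    using total by simp
  assume "\<exists>i\<in>I. 0 < \<epsilon> i"
  then obtain j where j: "j \<in> I" "0 < \<epsilon> j"
    by blast
  have "lam j * inverse (\<epsilon> j + inverse \<mu>) < lam j * \<mu>"
    using less_imp_inverse_less[of "inverse \<mu>" "\<epsilon> j + inverse \<mu>"] lam[OF j(1)] j(2) assms(2)
    by simp
  then have "(\<Sum>i\<in>I. lam i * inverse (\<epsilon> i + inverse \<mu>)) < (\<Sum>i\<in>I. lam i * \<mu>)"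
    using assms(1) le j(1) by (intro sum_strict_mono_ex1) auto
  then show "(\<Sum>i\<in>I. lam i * inverse (\<epsilon> i + inverse \<mu>)) < \<mu>"
    using total by simp
qed

lemma real_resolvent_average_nonneg:
  fixes lam \<epsilon> :: "'i \<Rightarrow> real"
  assumes "finite I" "0 < \<mu>" "\<And>i. i \<in> I \<Longrightarrow> 0 < lam i" "(\<Sum>i\<in>I. lam i) = 1"
    and "\<And>i. i \<in> I \<Longrightarrow> 0 \<le> \<epsilon> i"
  shows "0 \<le> real_resolvent_average \<mu> I \<epsilon> lam"
proof -
  have "0 < (\<Sum>i\<in>I. lam i * inverse (\<epsilon> i + inverse \<mu>))"
    using assms by (rule real_resolvent_average_sum_bounds(1))
  moreover have "(\<Sum>i\<in>I. lam i * inverse (\<epsilon> i + inverse \<mu>)) \<le> \<mu>"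
    using assms by (rule real_resolvent_average_sum_bounds(2))
  ultimately show ?thesis
    unfolding real_resolvent_average_def using le_imp_inverse_le by fastforce
qed

lemma real_resolvent_average_pos:
  fixes lam \<epsilon> :: "'i \<Rightarrow> real"
  assumes "finite I" "0 < \<mu>" "\<And>i. i \<in> I \<Longrightarrow> 0 < lam i" "(\<Sum>i\<in>I. lam i) = 1"
    and "\<And>i. i \<in> I \<Longrightarrow> 0 \<le> \<epsilon> i" and "\<exists>i\<in>I. 0 < \<epsilon> i"
  shows "0 < real_resolvent_average \<mu> I \<epsilon> lam"
proof -
  have "0 < (\<Sum>i\<in>I. lam i * inverse (\<epsilon> i + inverse \<mu>))"
    using assms(1-5) by (rule real_resolvent_average_sum_bounds(1))
  moreover have "(\<Sum>i\<in>I. lam i * inverse (\<epsilon> i + inverse \<mu>)) < \<mu>"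
    using assms by (rule real_resolvent_average_sum_bounds(3))
  ultimately show ?thesis
    unfolding real_resolvent_average_def using less_imp_inverse_less by fastforce
qed

lemma eps_monotone_resolvent_average:
  fixes A :: "'i \<Rightarrow> 'a::real_inner setmap" and lam \<epsilon> :: "'i \<Rightarrow> real"
  assumes fin: "finite I" and mu: "0 < \<mu>"
    and lam: "\<And>i. i \<in> I \<Longrightarrow> 0 < lam i" and sum1: "(\<Sum>i\<in>I. lam i) = 1"
    and mono: "\<And>i. i \<in> I \<Longrightarrow> eps_monotone (\<epsilon> i) (A i)"
  shows "eps_monotone (real_resolvent_average \<mu> I \<epsilon> lam) (resolvent_average \<mu> I A lam)"
proof -
  have eps: "0 \<le> \<epsilon> i" if "i \<in> I" for i
    using mono[OF that] by (simp add: eps_monotone_def)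
  define r where "r = (\<Sum>i\<in>I. lam i * inverse (\<epsilon> i + inverse \<mu>))"
  have r: "0 < r"
    unfolding r_def using fin mu lam sum1 eps by (rule real_resolvent_average_sum_bounds(1))
  have "real_resolvent_average \<mu> I \<epsilon> lam * (norm (x - y))\<^sup>2 \<le> inner (u - v) (x - y)"
    if u: "u \<in> resolvent_average \<mu> I A lam x" and v: "v \<in> resolvent_average \<mu> I A lam y" for x y u v
  proof -
    obtain p where p: "x = (\<Sum>i\<in>I. lam i *\<^sub>R p i)"
        "\<And>i. i \<in> I \<Longrightarrow> u + inverse \<mu> *\<^sub>R x - inverse \<mu> *\<^sub>R p i \<in> A i (p i)"
      using mem_resolvent_averageE[OF fin u] by blast
    obtain q where q: "y = (\<Sum>i\<in>I. lam i *\<^sub>R q i)"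
        "\<And>i. i \<in> I \<Longrightarrow> v + inverse \<mu> *\<^sub>R y - inverse \<mu> *\<^sub>R q i \<in> A i (q i)"
      using mem_resolvent_averageE[OF fin v] by blast
    define d where "d i = p i - q i" for i
    define z where "z = (u - v) + inverse \<mu> *\<^sub>R (x - y)"
    have xy: "x - y = (\<Sum>i\<in>I. lam i *\<^sub>R d i)"
      by (simp add: p(1) q(1) d_def scaleR_diff_right sum_subtractf)
    have summand: "(\<epsilon> i + inverse \<mu>) * (norm (d i))\<^sup>2 \<le> inner z (d i)" if "i \<in> I" for i
    proof -
      have "u + inverse \<mu> *\<^sub>R x - inverse \<mu> *\<^sub>R p i - (v + inverse \<mu> *\<^sub>R y - inverse \<mu> *\<^sub>R q i)
          = z - inverse \<mu> *\<^sub>R d i"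
        by (simp add: z_def d_def algebra_simps)
      then have "\<epsilon> i * (norm (d i))\<^sup>2 \<le> inner (z - inverse \<mu> *\<^sub>R d i) (d i)"
        using eps_monotoneD[OF mono[OF that] p(2)[OF that] q(2)[OF that]] by (simp add: d_def)
      then show ?thesis
        by (simp add: inner_diff_left distrib_right dot_square_norm)
    qed
    have "(norm (x - y))\<^sup>2 \<le> r * (\<Sum>i\<in>I. lam i * ((\<epsilon> i + inverse \<mu>) * (norm (d i))\<^sup>2))"
      unfolding xy r_def using lam eps mu
      by (intro norm_weighted_sum_sq_le) (auto intro: less_imp_le add_nonneg_pos)
    also have "\<dots> \<le> r * (\<Sum>i\<in>I. lam i * inner z (d i))"
      using r lam summand by (intro mult_left_mono sum_mono) (auto intro: less_imp_le)
    also have "(\<Sum>i\<in>I. lam i * inner z (d i)) = inner z (x - y)"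
      by (simp add: xy inner_sum_right)
    finally have "inverse r * (norm (x - y))\<^sup>2 \<le> inner z (x - y)"
      using r by (simp add: field_simps)
    then show ?thesis
      by (simp add: real_resolvent_average_def r_def[symmetric] z_def inner_add_left
          left_diff_distrib dot_square_norm)
  qed
  moreover have "0 \<le> real_resolvent_average \<mu> I \<epsilon> lam"
    using fin mu lam sum1 eps by (rule real_resolvent_average_nonneg)
  ultimately show ?thesis
    unfolding eps_monotone_def graph_def by blast
qed

theorem theorem3p20:
  fixes A :: "nat \<Rightarrow> 'a::{real_inner, complete_space} setmap"
    and \<mu> :: real and n :: nat and lam \<epsilon> :: "nat \<Rightarrow> real"
  assumes "0 < \<mu>"
    and "1 \<le> n"
    and "\<And>i. i \<in> {1..n} \<Longrightarrow> 0 < lam i"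
    and "(\<Sum>i\<in>{1..n}. lam i) = 1"
    and "\<And>i. i \<in> {1..n} \<Longrightarrow> 0 \<le> \<epsilon> i"
    and "\<And>i. i \<in> {1..n} \<Longrightarrow> maximally_monotone (A i)"
    and "\<And>i. i \<in> {1..n} \<Longrightarrow> eps_monotone (\<epsilon> i) (A i)"
  shows "eps_monotone (real_resolvent_average \<mu> {1..n} \<epsilon> lam) (resolvent_average \<mu> {1..n} A lam) \<and>
    ((\<exists>i\<^sub>0\<in>{1..n}. strongly_monotone (\<epsilon> i\<^sub>0) (A i\<^sub>0)) \<longrightarrow>
      strongly_monotone (real_resolvent_average \<mu> {1..n} \<epsilon> lam) (resolvent_average \<mu> {1..n} A lam))"
proof (intro conjI impI)
  show em: "eps_monotone (real_resolvent_average \<mu> {1..n} \<epsilon> lam) (resolvent_average \<mu> {1..n} A lam)"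
    using finite_atLeastAtMost assms(1,3,4,7) by (rule eps_monotone_resolvent_average)
  assume "\<exists>i\<^sub>0\<in>{1..n}. strongly_monotone (\<epsilon> i\<^sub>0) (A i\<^sub>0)"
  then have "\<exists>i\<in>{1..n}. 0 < \<epsilon> i"
    unfolding strongly_monotone_def by blast
  with finite_atLeastAtMost assms(1,3,4,5) have "0 < real_resolvent_average \<mu> {1..n} \<epsilon> lam"
    by (rule real_resolvent_average_pos)
  with em show "strongly_monotone (real_resolvent_average \<mu> {1..n} \<epsilon> lam)
      (resolvent_average \<mu> {1..n} A lam)"
    by (simp add: strongly_monotone_def)
qed

end
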